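(* Let $E$ be a finite set, let $\beta_1,\ldots,\beta_s\in\{-1,0,+1\}^E$ be nonzero column vectors, let $U$ be the $E\times s$ matrix with columns $\beta_1,\ldots,\beta_s$, and let $A=(a_{ij})=U^\dagger U$ be their Gram matrix, $a_{ij}=\langle\beta_i,\beta_j\rangle$. For each $i\in[s]$ let $C_i=\{e\in E:\beta_i(e)\neq 0\}$, and let $\mathcal{C}=\{C_1,\ldots,C_s\}$ (an indexed family). If $U$ is totally unimodular, then for all $\varnothing\neq S\subseteq[s]$ we have $f_A(S)=\phi_{\mathcal{C}}(S)$ and $g_A(S)=\gamma_{\mathcal{C}}(S)$, so that $U^\dagger U$ is $g$-nonnegative.
   Context: $[s]=\{1,\ldots,s\}$, $U^\dagger$ is the transpose of $U$, and $\langle\cdot,\cdot\rangle$ is the Euclidean dot product. An integer matrix is totally unimodular (TU) if every square submatrix has determinant in $\{-1,0,+1\}$. For a family $\mathcal{C}=\{C_1,\ldots,C_s\}$ of subsets of $E$ and $S\subseteq[s]$, define $$\phi_{\mathcal{C}}(S)=\Big|\bigcap_{i\in S}C_i\Big|,\qquad \gamma_{\mathcal{C}}(S)=\Big|\bigcap_{i\in S}C_i\setminus\bigcup_{j\in[s]\setminus S}C_j\Big|,$$ with the convention that the empty intersection is $E$. Let $A=(a_{ij})$ be an $s\times s$ symmetric integer matrix with positive diagonal entries. A three-element subset $\{h,i,j\}\subseteq[s]$ is a negative triple if $a_{hi}a_{ij}a_{jh}<0$; $\Delta(A)$ is the set of negative triples. Define $f_A:2^{[s]}\to\mathbb{N}$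 as follows: $f_A(\varnothing)=0$; $f_A(S)=0$ if $Y\subseteq S$ for some $Y\in\Delta(A)$; $f_A(\{i\})=a_{ii}$; and otherwise $f_A(S)=\min\{|a_{ij}|:\{i,j\}\subseteq S,\ i\ne j\}$. Define $g_A:2^{[s]}\to\mathbb{Z}$ by $$g_A(S)=\sum_{S\subseteq S'\subseteq[s]}(-1)^{|S'\setminus S|}f_A(S').$$ $A$ is $g$-nonnegative if $g_A(S)\ge 0$ for all $\varnothing\neq S\subseteq[s]$. *)

theory Defs
  imports "Jordan_Normal_Form.Determinant"
begin

text \<open>
  Matrices whose rows and columns are indexed by arbitrary finite sets are functions, relevant only
  on those index sets. As an index set carries no order, a square submatrix is given by injective
  enumerations of its rows and its columns; reordering only changes the sign of the determinant.
\<close>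

definition totally_unimodular :: "'r set \<Rightarrow> 'c set \<Rightarrow> ('r \<Rightarrow> 'c \<Rightarrow> int) \<Rightarrow> bool" where
  "totally_unimodular R C U \<longleftrightarrow>
    (\<forall>k r c. inj_on r {..<k} \<and> r ` {..<k} \<subseteq> R \<and> inj_on c {..<k} \<and> c ` {..<k} \<subseteq> C \<longrightarrow>
      det (mat k k (\<lambda>(i, j). U (r i) (c j))) \<in> {- 1, 0, 1})"

definition matrix_of_columns :: "('c \<Rightarrow> 'r \<Rightarrow> int) \<Rightarrow> 'r \<Rightarrow> 'c \<Rightarrow> int" where
  "matrix_of_columns \<beta> e i = \<beta> i e"

definition gram :: "'r set \<Rightarrow> ('r \<Rightarrow> 'c \<Rightarrow> int) \<Rightarrow> 'c \<Rightarrow> 'c \<Rightarrow> int" where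
  "gram R U i j = (\<Sum>e\<in>R. U e i * U e j)"

definition supp :: "'r set \<Rightarrow> ('r \<Rightarrow> int) \<Rightarrow> 'r set" where
  "supp E b = {e \<in> E. b e \<noteq> 0}"

text \<open>Intersecting with the ground set makes the empty intersection equal to it.\<close>

definition phi :: "'e set \<Rightarrow> (nat \<Rightarrow> 'e set) \<Rightarrow> nat set \<Rightarrow> nat" where
  "phi E C S = card (E \<inter> (\<Inter>i\<in>S. C i))"

definition gamma :: "'e set \<Rightarrow> nat \<Rightarrow> (nat \<Rightarrow> 'e set) \<Rightarrow> nat set \<Rightarrow> nat" where
  "gamma E s C S = card ((E \<inter> (\<Inter>i\<in>S. C i)) - (\<Union>j\<in>{1..s} - S. C j))"

definition negative_triples :: "nat \<Rightarrow> (nat \<Rightarrow> nat \<Rightarrow> int) \<Rightarrow> nat set set" where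
  "negative_triples s A =
    {{h, i, j} | h i j. {h, i, j} \<subseteq> {1..s} \<and> h \<noteq> i \<and> i \<noteq> j \<and> h \<noteq> j \<and> A h i * A i j * A j h < 0}"

text \<open>
  The matrix \<open>A\<close> is meant to be symmetric with positive diagonal entries (on \<open>{1..s}\<close>), so that
  \<open>nat\<close> does not truncate the diagonal entry below.
\<close>

definition f_of :: "nat \<Rightarrow> (nat \<Rightarrow> nat \<Rightarrow> int) \<Rightarrow> nat set \<Rightarrow> nat" where
  "f_of s A S =
    (if S = {} then 0
     else if \<exists>Y\<in>negative_triples s A. Y \<subseteq> S then 0
     else if card S = 1 then nat (A (the_elem S) (the_elem S))
     else Min {nat \<bar>A i j\<bar> | i j. {i, j} \<subseteq> S \<and> i \<noteq> j})"

definition g_of :: "nat \<Rightarrow> (nat \<Rightarrow> nat \<Rightarrow> int) \<Rightarrow> nat set \<Rightarrow> int" where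
  "g_of s A S = (\<Sum>S' | S \<subseteq> S' \<and> S' \<subseteq> {1..s}. (- 1) ^ card (S' - S) * int (f_of s A S'))"

definition g_nonnegative :: "nat \<Rightarrow> (nat \<Rightarrow> nat \<Rightarrow> int) \<Rightarrow> bool" where
  "g_nonnegative s A \<longleftrightarrow> (\<forall>S. S \<noteq> {} \<and> S \<subseteq> {1..s} \<longrightarrow> g_of s A S \<ge> 0)"

lemma gram_symmetric: "gram R U i j = gram R U j i"
  by (simp add: gram_def mult.commute)

lemma gram_diag_pos:
  assumes "finite R" "e \<in> R" "U e i \<noteq> 0"
  shows "gram R U i i > 0"
  unfolding gram_def using assms
  by (intro sum_pos2[of _ e]) (auto simp: zero_less_mult_iff)

end

theory Submission
  imports Defs
begin

text \<open>
  Write \<open>X i\<close> for the support of the column \<open>i\<close> of \<open>U\<close>, and \<open>a i j\<close> for the entries of the Gram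
  matrix. The minors of order two and three of \<open>U\<close> force a structure on the supports that determines
  all their intersections.

  If two rows \<open>e\<close>, \<open>e'\<close> in \<open>X i \<inter> X j\<close> gave products \<open>U e i * U e j\<close> and \<open>U e' i * U e' j\<close> of
  opposite signs, the minor on these rows and columns would be \<open>2\<close> or \<open>- 2\<close>. So nothing cancels in
  the sum that defines \<open>a i j\<close>: its absolute value is \<open>card (X i \<inter> X j)\<close>, and its sign is
  the sign of the product in any row of \<open>X i \<inter> X j\<close>. A row common to \<open>X h\<close>, \<open>X i\<close> and \<open>X j\<close>
  therefore gives \<open>a h i * a i j * a j h\<close> the sign of a square, which settles the case of a set \<open>S\<close>
  that contains a negative triple: there the intersection of the supports is empty
  (\<open>negative_triple_disjoint\<close>).

  For a triple that is not negative, one of the pairwise intersections of supports lies in the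
  remaining support (\<open>nonnegative_triple_nested\<close>). Otherwise three rows, each outside exactly one of the
  supports, form a minor with the pattern of the incidence matrix of a triangle, whose determinant
  is a sum of two nonzero terms of equal sign.

  This nesting carries over from triples to arbitrary \<open>S\<close> by a minimality argument: a pair with the
  smallest intersection has its intersection contained in every other support
  (\<open>Inter_eq_smallest_pair\<close>). Hence the intersection over \<open>S\<close> has as many elements as the smallest
  pairwise one, which is the identity between \<open>f\<close> and \<open>phi\<close>. The identity between \<open>g\<close> and \<open>gamma\<close>
  is then inclusion-exclusion (\<open>gamma_eq_alternating_sum_phi\<close>), and \<open>g\<close> is nonnegative because it
  counts.
\<close>

section \<open>Minors of order two and three\<close>

lemma det_mat_2:
  "det (mat 2 2 f) = f (0, 0) * f (1, 1) - f (0, 1) * (f (1, 0) :: 'a :: comm_ring_1)"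
  by (subst laplace_expansion_row[of _ 2 0])
     (simp_all add: cofactor_def mat_delete_def det_single numeral_2_eq_2)

lemma det_mat_3:
  "det (mat 3 3 f) =
     f (0, 0) * (f (1, 1) * f (2, 2) - f (1, 2) * f (2, 1))
   - f (0, 1) * (f (1, 0) * f (2, 2) - f (1, 2) * f (2, 0))
   + f (0, 2) * (f (1, 0) * f (2, 1) - f (1, 1) * (f (2, 0) :: 'a :: comm_ring_1))"
  by (subst laplace_expansion_row[of _ 3 0])
     (simp_all add: cofactor_def mat_delete_def numeral_3_eq_3 det_mat_2[unfolded numeral_2_eq_2] numeral_2_eq_2
        algebra_simps)

lemma totally_unimodular_minor_2:
  assumes "totally_unimodular R C U"
    and "{e, e'} \<subseteq> R" "e \<noteq> e'" "{i, j} \<subseteq> C" "i \<noteq> j"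
  shows "U e i * U e' j - U e j * U e' i \<in> {- 1, 0, 1}"
proof -
  have "inj_on (\<lambda>n. [e, e'] ! n) {..<2} \<and> (\<lambda>n. [e, e'] ! n) ` {..<2} \<subseteq> R \<and>
        inj_on (\<lambda>n. [i, j] ! n) {..<2} \<and> (\<lambda>n. [i, j] ! n) ` {..<2} \<subseteq> C"
    using assms by (auto simp: inj_on_def numeral_2_eq_2 less_Suc_eq)
  with assms(1) have "det (mat 2 2 (\<lambda>(m, n). U ([e, e'] ! m) ([i, j] ! n))) \<in> {- 1, 0, 1}"
    unfolding totally_unimodular_def by blast
  then show ?thesis
    by (simp add: det_mat_2)
qed

lemma totally_unimodular_minor_3:
  assumes "totally_unimodular R C U"
    and "{e, e', e''} \<subseteq> R" "distinct [e, e', e'']" "{h, i, j} \<subseteq> C" "distinct [h, i, j]"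
  shows "U e h * (U e' i * U e'' j - U e' j * U e'' i)
       - U e i * (U e' h * U e'' j - U e' j * U e'' h)
       + U e j * (U e' h * U e'' i - U e' i * U e'' h) \<in> {- 1, 0, 1}"
proof -
  have "inj_on (\<lambda>n. [e, e', e''] ! n) {..<3} \<and> (\<lambda>n. [e, e', e''] ! n) ` {..<3} \<subseteq> R \<and>
        inj_on (\<lambda>n. [h, i, j] ! n) {..<3} \<and> (\<lambda>n. [h, i, j] ! n) ` {..<3} \<subseteq> C"
    using assms by (auto simp: inj_on_def numeral_3_eq_3 less_Suc_eq)
  with assms(1)
  have "det (mat 3 3 (\<lambda>(m, n). U ([e, e', e''] ! m) ([h, i, j] ! n))) \<in> {- 1, 0, 1}"
    unfolding totally_unimodular_def by blast
  then show ?thesis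
    by (simp add: det_mat_3)
qed

section \<open>Gram matrices of totally unimodular matrices\<close>

text \<open>
  Products of opposite signs in the rows \<open>e\<close> and \<open>e'\<close> would make the two terms of the minor
  \<open>U e i * U e' j - U e j * U e' i\<close> add up instead of cancelling.
\<close>
lemma column_products_same_sign:
  assumes "totally_unimodular R C U"
    and entries: "\<And>e i. e \<in> R \<Longrightarrow> i \<in> C \<Longrightarrow> U e i \<in> {- 1, 0, 1}"
    and "e \<in> R" "e' \<in> R" "i \<in> C" "j \<in> C"
  shows "0 \<le> (U e i * U e j) * (U e' i * U e' j)"
proof (cases "e = e' \<or> i = j")
  case False
  then have "U e i * U e' j - U e j * U e' i \<in> {- 1, 0, 1}"
    using assms by (intro totally_unimodular_minor_2[of R C]) auto
  with entries[of e i] entries[of e j] entries[of e' i] entries[of e' j] show ?thesis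
    using assms(3-6) by auto
next
  case True
  then show ?thesis
    by (elim disjE) (simp_all only: zero_le_square mult_nonneg_nonneg)
qed

text \<open>
  Multiplying the Gram entry by the product in a single row of the common support normalises all its
  terms to \<open>0\<close> or \<open>1\<close>, so that it counts. Both the absolute value and the sign of the entry can be
  read off from this.
\<close>
lemma product_times_gram:
  assumes "finite R" "totally_unimodular R C U"
    and entries: "\<And>e i. e \<in> R \<Longrightarrow> i \<in> C \<Longrightarrow> U e i \<in> {- 1, 0, 1}"
    and "e \<in> R" "i \<in> C" "j \<in> C" "U e i \<noteq> 0" "U e j \<noteq> 0"
  shows "(U e i * U e j) * gram R U i j
       = int (card (supp R (\<lambda>e. U e i) \<inter> supp R (\<lambda>e. U e j)))"
proof -
  have "(U e i * U e j) * gram R U i j = (\<Sum>e'\<in>R. (U e i * U e j) * (U e' i * U e' j))"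
    by (simp add: gram_def sum_distrib_left)
  also have "\<dots> = (\<Sum>e'\<in>R. if U e' i \<noteq> 0 \<and> U e' j \<noteq> 0 then 1 else 0)"
  proof (rule sum.cong[OF refl])
    fix e' assume e': "e' \<in> R"
    show "(U e i * U e j) * (U e' i * U e' j) = (if U e' i \<noteq> 0 \<and> U e' j \<noteq> 0 then 1 else 0)"
      using column_products_same_sign[OF assms(2) entries assms(4) e' assms(5,6)]
        entries[OF assms(4,5)] entries[OF assms(4,6)] entries[OF e' assms(5)]
        entries[OF e' assms(6)] assms(7,8) by auto
  qed
  also have "\<dots> = int (card {e'\<in>R. U e' i \<noteq> 0 \<and> U e' j \<noteq> 0})"
    using assms(1) by (simp add: sum.If_cases Int_def)
  also have "{e'\<in>R. U e' i \<noteq> 0 \<and> U e' j \<noteq> 0} = supp R (\<lambda>e. U e i) \<inter> supp R (\<lambda>e. U e j)"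
    by (auto simp: supp_def)
  finally show ?thesis .
qed

lemma product_times_gram_pos:
  assumes "finite R" "totally_unimodular R C U"
    and entries: "\<And>e i. e \<in> R \<Longrightarrow> i \<in> C \<Longrightarrow> U e i \<in> {- 1, 0, 1}"
    and "e \<in> R" "i \<in> C" "j \<in> C" "U e i \<noteq> 0" "U e j \<noteq> 0"
  shows "0 < (U e i * U e j) * gram R U i j"
proof -
  have "e \<in> supp R (\<lambda>e. U e i) \<inter> supp R (\<lambda>e. U e j)"
    using assms(4,7,8) by (simp add: supp_def)
  then have "0 < card (supp R (\<lambda>e. U e i) \<inter> supp R (\<lambda>e. U e j))"
    using assms(1) by (auto simp: card_gt_0_iff supp_def)
  then show ?thesis
    using product_times_gram[OF assms] by simp
qed

lemma abs_gram_eq_card_common_support: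
  assumes "finite R" "totally_unimodular R C U"
    and entries: "\<And>e i. e \<in> R \<Longrightarrow> i \<in> C \<Longrightarrow> U e i \<in> {- 1, 0, 1}"
    and "i \<in> C" "j \<in> C"
  shows "nat \<bar>gram R U i j\<bar> = card (supp R (\<lambda>e. U e i) \<inter> supp R (\<lambda>e. U e j))"
proof (cases "\<exists>e\<in>R. U e i \<noteq> 0 \<and> U e j \<noteq> 0")
  case True
  then obtain e where e: "e \<in> R" "U e i \<noteq> 0" "U e j \<noteq> 0"
    by blast
  have "\<bar>U e i * U e j\<bar> = 1"
    using entries[OF e(1) assms(4)] entries[OF e(1) assms(5)] e by auto
  then have "\<bar>gram R U i j\<bar> = \<bar>(U e i * U e j) * gram R U i j\<bar>"
    by (simp add: abs_mult)
  then show ?thesis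
    using product_times_gram[OF assms(1,2) entries e(1) assms(4,5) e(2,3)] by simp
next
  case False
  then have "gram R U i j = 0" "supp R (\<lambda>e. U e i) \<inter> supp R (\<lambda>e. U e j) = {}"
    by (auto simp: gram_def supp_def intro!: sum.neutral)
  then show ?thesis
    by simp
qed

section \<open>Triples of columns\<close>

text \<open>
  In a row where all three columns are nonzero, each Gram entry has the sign of the corresponding
  product of entries of \<open>U\<close>, and these three products multiply to a square.
\<close>
lemma negative_triple_disjoint:
  assumes "finite R" "totally_unimodular R C U"
    and entries: "\<And>e i. e \<in> R \<Longrightarrow> i \<in> C \<Longrightarrow> U e i \<in> {- 1, 0, 1}"
    and "h \<in> C" "i \<in> C" "j \<in> C" "e \<in> R"
    and neg: "gram R U h i * gram R U i j * gram R U j h < 0"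
  shows "U e h = 0 \<or> U e i = 0 \<or> U e j = 0"
proof (rule ccontr)
  assume "\<not> ?thesis"
  then have nz: "U e h \<noteq> 0" "U e i \<noteq> 0" "U e j \<noteq> 0"
    by auto
  note pos = product_times_gram_pos[OF assms(1,2) entries \<open>e \<in> R\<close>]
  have "0 < ((U e h * U e i) * gram R U h i) * ((U e i * U e j) * gram R U i j) *
            ((U e j * U e h) * gram R U j h)"
    using nz assms(4-6)
    by (intro mult_pos_pos[OF mult_pos_pos[OF pos[of h i] pos[of i j]] pos[of j h]]) auto
  also have "\<dots> = (U e h * U e i * U e j)\<^sup>2 * (gram R U h i * gram R U i j * gram R U j h)"
    by (simp add: power2_eq_square mult_ac)
  finally have "0 < gram R U h i * gram R U i j * gram R U j h"
    by (simp add: zero_less_mult_iff)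
  with neg show False
    by simp
qed

text \<open>
  A failure of all three inclusions provides rows in which exactly \<open>h, i\<close>, exactly \<open>i, j\<close> and
  exactly \<open>j, h\<close> are nonzero. Their minor is the sum of the two cyclic terms \<open>u\<close> and \<open>v\<close> below, and
  \<open>u * v\<close> is the product of the three pairwise products, which has the sign of
  \<open>a h i * a i j * a j h\<close> for \<open>a\<close> the Gram matrix. The witnesses make all three Gram entries nonzero,
  so the triple, assumed not to be negative, is positive and the terms cannot cancel.
\<close>
lemma nonnegative_triple_nested:
  assumes "finite R" "totally_unimodular R C U"
    and entries: "\<And>e i. e \<in> R \<Longrightarrow> i \<in> C \<Longrightarrow> U e i \<in> {- 1, 0, 1}"
    and "{h, i, j} \<subseteq> C" "distinct [h, i, j]"
    and nonneg: "0 \<le> gram R U h i * gram R U i j * gram R U j h"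
    and X: "X = (\<lambda>i. supp R (\<lambda>e. U e i))"
  shows "X h \<inter> X i \<subseteq> X j \<or> X i \<inter> X j \<subseteq> X h \<or> X j \<inter> X h \<subseteq> X i"
proof (rule ccontr)
  assume "\<not> ?thesis"
  then obtain e e' e'' where
    e: "e \<in> R" "U e h \<noteq> 0" "U e i \<noteq> 0" "U e j = 0" and
    e': "e' \<in> R" "U e' i \<noteq> 0" "U e' j \<noteq> 0" "U e' h = 0" and
    e'': "e'' \<in> R" "U e'' j \<noteq> 0" "U e'' h \<noteq> 0" "U e'' i = 0"
    unfolding X by (auto simp: supp_def)
  define u v where "u = U e h * U e' i * U e'' j" and "v = U e i * U e' j * U e'' h"
  note pos = product_times_gram_pos[OF assms(1,2) entries]
  have "0 < ((U e h * U e i) * gram R U h i) * ((U e' i * U e' j) * gram R U i j) *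
            ((U e'' j * U e'' h) * gram R U j h)"
    using e e' e'' assms(4)
    by (intro mult_pos_pos[OF mult_pos_pos[OF pos[of e h i] pos[of e' i j]] pos[of e'' j h]]) auto
  also have "\<dots> = (u * v) * (gram R U h i * gram R U i j * gram R U j h)"
    by (simp add: u_def v_def mult_ac)
  finally have "0 < u * v"
    using nonneg by (auto simp: zero_less_mult_iff)
  moreover have "u + v \<in> {- 1, 0, 1}"
    using totally_unimodular_minor_3[of R C U e e' e'' h i j] assms(2,4,5) e e' e''
    by (auto simp: u_def v_def mult_ac)
  ultimately show False
    by (auto simp: zero_less_mult_iff)
qed

section \<open>Arbitrary sets of columns\<close>

text \<open>
  Suppose that a smallest pairwise intersection \<open>X i \<inter> X j\<close> is not contained in \<open>X k\<close>. The nesting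
  of the triple \<open>i, j, k\<close> then puts \<open>X j \<inter> X k\<close> inside \<open>X i\<close> or \<open>X k \<inter> X i\<close> inside \<open>X j\<close>. This
  makes a pairwise intersection a subset of \<open>X i \<inter> X j\<close>, and a proper one as it lies in \<open>X k\<close>.
\<close>
lemma Inter_eq_smallest_pair:
  fixes X :: "'i \<Rightarrow> 'e set"
  assumes fin: "\<And>k. k \<in> S \<Longrightarrow> finite (X k)"
    and nested: "\<And>h i j. {h, i, j} \<subseteq> S \<Longrightarrow> distinct [h, i, j] \<Longrightarrow>
      X h \<inter> X i \<subseteq> X j \<or> X i \<inter> X j \<subseteq> X h \<or> X j \<inter> X h \<subseteq> X i"
    and ij: "i \<in> S" "j \<in> S" "i \<noteq> j"
    and minimal: "\<And>h k. h \<in> S \<Longrightarrow> k \<in> S \<Longrightarrow> h \<noteq> k \<Longrightarrow> card (X i \<inter> X j) \<le> card (X h \<inter> X k)"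
  shows "(\<Inter>k\<in>S. X k) = X i \<inter> X j"
proof -
  have "X i \<inter> X j \<subseteq> X k" if k: "k \<in> S" for k
  proof (rule ccontr)
    assume not_sub: "\<not> X i \<inter> X j \<subseteq> X k"
    then have ne: "k \<noteq> i" "k \<noteq> j"
      by auto
    have "X j \<inter> X k \<subset> X i \<inter> X j \<or> X k \<inter> X i \<subset> X i \<inter> X j"
      using nested[of i j k] k ij ne not_sub by auto
    then have "card (X j \<inter> X k) < card (X i \<inter> X j) \<or> card (X k \<inter> X i) < card (X i \<inter> X j)"
      using fin[OF ij(1)] by (auto intro: psubset_card_mono)
    with minimal[of j k] minimal[of k i] k ij ne show False
      by auto
  qed
  with ij show ?thesis
    by blast
qed

text \<open>
  The three defining cases of \<open>f\<close> on a nonempty set correspond to an empty intersection, to a single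
  support, and to a smallest pairwise intersection that is the whole intersection.
\<close>
lemma f_of_gram_eq_phi:
  fixes U :: "'e \<Rightarrow> nat \<Rightarrow> int"
  assumes "finite E" "totally_unimodular E {1..s} U"
    and entries: "\<And>e i. e \<in> E \<Longrightarrow> i \<in> {1..s} \<Longrightarrow> U e i \<in> {- 1, 0, 1}"
    and S: "S \<noteq> {}" "S \<subseteq> {1..s}"
    and X: "X = (\<lambda>i. supp E (\<lambda>e. U e i))"
  shows "f_of s (gram E U) S = phi E X S"
proof -
  have abs_gram: "nat \<bar>gram E U i j\<bar> = card (X i \<inter> X j)" if "i \<in> {1..s}" "j \<in> {1..s}" for i j
    unfolding X using entries that by (rule abs_gram_eq_card_common_support[OF assms(1,2)])
  have finS: "finite S"
    using S(2) finite_subset by blast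
  have XE: "X i \<subseteq> E" for i
    by (auto simp: X supp_def)
  consider
    (negative) Y where "Y \<in> negative_triples s (gram E U)" "Y \<subseteq> S"
    | (singleton) i where "\<not> (\<exists>Y\<in>negative_triples s (gram E U). Y \<subseteq> S)" "S = {i}"
    | (several) "\<not> (\<exists>Y\<in>negative_triples s (gram E U). Y \<subseteq> S)" "card S \<noteq> 1"
    by (metis card_1_singletonE)
  then show ?thesis
  proof cases
    case negative
    then obtain h i j where hij: "{h, i, j} \<subseteq> S" "gram E U h i * gram E U i j * gram E U j h < 0"
      by (auto simp: negative_triples_def)
    then have in_range: "h \<in> {1..s}" "i \<in> {1..s}" "j \<in> {1..s}"
      using S(2) by blast+
    have "U e h = 0 \<or> U e i = 0 \<or> U e j = 0" if "e \<in> E" for e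
      using entries in_range that hij(2) by (rule negative_triple_disjoint[OF assms(1,2)])
    then have "E \<inter> (\<Inter>i\<in>S. X i) = {}"
      using hij(1) by (auto simp: X supp_def)
    with negative S(1) show ?thesis
      by (auto simp: f_of_def phi_def)
  next
    case (singleton i)
    have "0 \<le> gram E U i i"
      by (simp add: gram_def sum_nonneg)
    then have "nat (gram E U i i) = card (X i)"
      using abs_gram[of i i] singleton(2) S(2) by simp
    then show ?thesis
      using singleton XE[of i] by (simp add: f_of_def phi_def Int_absorb1)
  next
    case several
    define P where "P = {(i, j). {i, j} \<subseteq> S \<and> i \<noteq> j}"
    have finP: "finite P"
      by (rule finite_subset[of _ "S \<times> S"]) (auto simp: P_def finS)
    have "P \<noteq> {}"
    proof -
      obtain i where "i \<in> S"
        using S(1) by blast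
      moreover from this obtain j where "j \<in> S" "j \<noteq> i"
        using several(2) by (metis is_singletonI' is_singleton_altdef empty_iff)
      ultimately show ?thesis
        by (auto simp: P_def)
    qed
    let ?m = "\<lambda>(i, j). card (X i \<inter> X j)"
    have "{nat \<bar>gram E U i j\<bar> | i j. {i, j} \<subseteq> S \<and> i \<noteq> j} = (\<lambda>(i, j). nat \<bar>gram E U i j\<bar>) ` P"
      by (auto simp: P_def)
    also have "\<dots> = ?m ` P"
      using S(2) by (intro image_cong refl) (auto simp: P_def intro!: abs_gram)
    finally have f: "f_of s (gram E U) S = Min (?m ` P)"
      using several S(1) by (simp add: f_of_def)
    obtain i j where ij: "(i, j) \<in> P" "Min (?m ` P) = card (X i \<inter> X j)"
    proof -
      have "Min (?m ` P) \<in> ?m ` P"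
        using finP \<open>P \<noteq> {}\<close> by (intro Min_in) auto
      then show thesis
        by (elim imageE) (auto intro: that)
    qed
    have minimal: "card (X i \<inter> X j) \<le> card (X h \<inter> X k)" if "h \<in> S" "k \<in> S" "h \<noteq> k" for h k
      unfolding ij(2)[symmetric] using finP that
      by (intro Min_le) (auto simp: P_def intro!: image_eqI[of _ _ "(h, k)"])
    have "(\<Inter>k\<in>S. X k) = X i \<inter> X j"
    proof (rule Inter_eq_smallest_pair[OF _ _ _ _ _ minimal])
      show "finite (X k)" for k
        using XE assms(1) finite_subset by blast
      fix h i j assume "{h, i, j} \<subseteq> S" and "distinct [h, i, j]"
      moreover from this have "0 \<le> gram E U h i * gram E U i j * gram E U j h"
        using several(1) S(2) unfolding negative_triples_def
        by (smt (verit, del_insts) distinct_length_2_or_more mem_Collect_eq subset_trans)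
      ultimately show "X h \<inter> X i \<subseteq> X j \<or> X i \<inter> X j \<subseteq> X h \<or> X j \<inter> X h \<subseteq> X i"
        using S(2) by (intro nonnegative_triple_nested[OF assms(1,2) entries _ _ _ X]) auto
    qed (use ij(1) in \<open>auto simp: P_def\<close>)
    then show ?thesis
      using f ij(2) XE[of i] by (simp add: phi_def Int_absorb1 le_infI1)
  qed
qed

section \<open>Inclusion-exclusion\<close>

text \<open>
  The sets between \<open>S\<close> and \<open>T\<close> form a Boolean lattice, in which even and odd members are
  equinumerous unless it is a single point.
\<close>
lemma sum_signs_between:
  assumes "finite T" "S \<subseteq> T"
  shows "(\<Sum>S' | S \<subseteq> S' \<and> S' \<subseteq> T. (- 1) ^ card (S' - S)) = (if T = S then 1 else 0 :: int)"
proof (cases "T = S")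
  case True
  then have "{S'. S \<subseteq> S' \<and> S' \<subseteq> T} = {S}"
    by auto
  with True show ?thesis
    by simp
next
  case False
  have "(- 1 :: int) ^ card (S' - S) = (- 1) ^ card S * (- 1) ^ card S'"
    if "S \<subseteq> S'" "S' \<subseteq> T" for S'
  proof -
    have "finite S'" "finite S"
      using that assms finite_subset by blast+
    then have "card S' = card S + card (S' - S)"
      using that(1) by (simp add: card_Diff_subset card_mono)
    then show ?thesis
      by (simp add: power_add flip: mult.assoc power_mult_distrib)
  qed
  then have "(\<Sum>S' | S \<subseteq> S' \<and> S' \<subseteq> T. (- 1) ^ card (S' - S))
           = (- 1 :: int) ^ card S * (\<Sum>S' | S \<subseteq> S' \<and> S' \<subseteq> T. (- 1) ^ card S')"
    by (simp add: sum_distrib_left)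
  also have "(\<Sum>S' | S \<subseteq> S' \<and> S' \<subseteq> T. (- 1 :: int) ^ card S') = 0"
    using assms False card_subsupersets_even_odd[of T S]
    by (intro sum_alternating_cancels) (auto simp: conj_ac)
  finally show ?thesis
    using False by simp
qed

text \<open>
  Counting per element of \<open>E\<close>: if \<open>T e\<close> is the set of indices \<open>i\<close> with \<open>e \<in> C i\<close>, then \<open>e\<close>
  contributes the signs of all sets between \<open>S\<close> and \<open>T e\<close>, and these cancel unless \<open>T e = S\<close>, which
  is the condition for \<open>e\<close> to be counted by \<open>gamma\<close>.
\<close>
lemma gamma_eq_alternating_sum_phi:
  assumes "finite E" "S \<subseteq> {1..s}"
  shows "int (gamma E s C S)
       = (\<Sum>S' | S \<subseteq> S' \<and> S' \<subseteq> {1..s}. (- 1) ^ card (S' - S) * int (phi E C S'))"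
proof -
  let ?supersets = "{S'. S \<subseteq> S' \<and> S' \<subseteq> {1..s}}"
  define T where "T e = {i \<in> {1..s}. e \<in> C i}" for e
  have fin: "finite ?supersets"
    by (rule finite_subset[of _ "Pow {1..s}"]) auto
  have phi_sum: "int (phi E C S') = (\<Sum>e\<in>E. if S' \<subseteq> T e then 1 else 0)" if "S' \<subseteq> {1..s}" for S'
  proof -
    have "E \<inter> (\<Inter>i\<in>S'. C i) = E \<inter> {e. S' \<subseteq> T e}"
      using that by (auto simp: T_def)
    then show ?thesis
      using assms(1) by (simp add: phi_def sum.If_cases)
  qed
  have "(\<Sum>S'\<in>?supersets. (- 1) ^ card (S' - S) * int (phi E C S'))
      = (\<Sum>S'\<in>?supersets. \<Sum>e\<in>E. if S' \<subseteq> T e then (- 1) ^ card (S' - S) else 0)"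
    by (intro sum.cong refl) (auto simp: phi_sum sum_distrib_left intro!: sum.cong)
  also have "\<dots> = (\<Sum>e\<in>E. \<Sum>S'\<in>?supersets. if S' \<subseteq> T e then (- 1) ^ card (S' - S) else 0)"
    by (rule sum.swap)
  also have "\<dots> = (\<Sum>e\<in>E. if T e = S then 1 else 0)"
  proof (rule sum.cong[OF refl])
    fix e
    have sub: "T e \<subseteq> {1..s}"
      by (auto simp: T_def)
    have "(\<Sum>S'\<in>?supersets. if S' \<subseteq> T e then (- 1) ^ card (S' - S) else 0)
        = (\<Sum>S' | S \<subseteq> S' \<and> S' \<subseteq> T e. (- 1 :: int) ^ card (S' - S))"
      using fin sub by (intro sum.mono_neutral_cong_right) auto
    also have "\<dots> = (if T e = S then 1 else 0)"
    proof (cases "S \<subseteq> T e")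
      case True
      then show ?thesis
        using sub by (intro sum_signs_between) (auto intro: finite_subset)
    next
      case False
      then have "{S'. S \<subseteq> S' \<and> S' \<subseteq> T e} = {}" "T e \<noteq> S"
        by auto
      then show ?thesis
        by (simp only: sum.empty if_False)
    qed
    finally show "(\<Sum>S'\<in>?supersets. if S' \<subseteq> T e then (- 1) ^ card (S' - S) else 0)
        = (if T e = S then 1 else 0 :: int)" .
  qed
  also have "\<dots> = int (card (E \<inter> {e. T e = S}))"
    using assms(1) by (simp add: sum.If_cases)
  also have "E \<inter> {e. T e = S} = (E \<inter> (\<Inter>i\<in>S. C i)) - (\<Union>j\<in>{1..s} - S. C j)"
    using assms(2) by (auto simp: T_def)
  finally show ?thesis
    by (simp add: gamma_def)
qed

theorem proposition14:
  fixes E :: "'e set" and s :: nat and \<beta> :: "nat \<Rightarrow> 'e \<Rightarrow> int"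
    and U :: "'e \<Rightarrow> nat \<Rightarrow> int" and A :: "nat \<Rightarrow> nat \<Rightarrow> int" and C :: "nat \<Rightarrow> 'e set"
  assumes "finite E"
    and "\<And>i e. i \<in> {1..s} \<Longrightarrow> e \<in> E \<Longrightarrow> \<beta> i e \<in> {- 1, 0, 1}"
    and "\<And>i. i \<in> {1..s} \<Longrightarrow> \<exists>e\<in>E. \<beta> i e \<noteq> 0"
    and "U = matrix_of_columns \<beta>"
    and "A = gram E U"
    and "C = (\<lambda>i. supp E (\<beta> i))"
    and "totally_unimodular E {1..s} U"
  shows "(\<forall>S. S \<noteq> {} \<and> S \<subseteq> {1..s} \<longrightarrow>
            f_of s A S = phi E C S \<and> g_of s A S = int (gamma E s C S)) \<and>
         g_nonnegative s A"
proof -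
  have entries: "U e i \<in> {- 1, 0, 1}" if "e \<in> E" "i \<in> {1..s}" for e i
    using assms(2,4) that by (simp add: matrix_of_columns_def)
  have C: "C = (\<lambda>i. supp E (\<lambda>e. U e i))"
    by (simp add: assms(4,6) matrix_of_columns_def)
  have f: "f_of s A S = phi E C S" if "S \<noteq> {}" "S \<subseteq> {1..s}" for S
    unfolding assms(5) using assms(1,7) entries that C by (rule f_of_gram_eq_phi)
  have g: "g_of s A S = int (gamma E s C S)" if S: "S \<noteq> {}" "S \<subseteq> {1..s}" for S
  proof -
    \<comment> \<open>\<open>S\<close> is nonempty, so the empty set, where \<open>phi\<close> counts all of \<open>E\<close> but \<open>f\<close> is \<open>0\<close>, is not summed over.\<close>
    have "f_of s A S' = phi E C S'" if "S \<subseteq> S'" "S' \<subseteq> {1..s}" for S'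
      using f[of S'] that S(1) by blast
    then show ?thesis
      unfolding g_of_def gamma_eq_alternating_sum_phi[OF assms(1) S(2)] by simp
  qed
  show ?thesis
    using f g by (simp add: g_nonnegative_def)
qed

end
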